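(* Let $A$ be a Banach algebra. (1) Let $B$ be a left Banach $A$-module with module action $\pi_\ell:A\times B\to B$, and let $a''\in A^{**}$. Then $a''\in Z_{B^{**}}(A^{**})$ if and only if $\pi_\ell^{****}(b',a'')\in B^*$ for all $b'\in B^*$. (2) Let $B$ be a right Banach $A$-module with module action $\pi_r:B\times A\to B$, and let $b''\in B^{**}$. Then $b''\in Z_{A^{**}}(B^{**})$ if and only if $\pi_r^{****}(b',b'')\in A^*$ for all $b'\in B^*$.
   Context: For normed spaces $X,Y,Z$ and a bounded bilinear map $m:X\times Y\to Z$, the adjoint $m^*:Z^*\times X\to Y^*$ is defined by $\langle m^*(z',x),y\rangle=\langle z',m(x,y)\rangle$. Iterating, $m^{**}:Y^{**}\times Z^*\to X^*$ is given by $\langle m^{**}(y'',z'),x\rangle=\langle y'',m^*(z',x)\rangle$, $m^{***}:X^{**}\times Y^{**}\to Z^{**}$ by $\langle m^{***}(x'',y''),z'\rangle=\langle x'',m^{**}(y'',z')\rangle$, and $m^{****}:Z^{***}\times X^{**}\to Y^{***}$ by $\langle m^{****}(z''',x''),y''\rangle=\langle z''',m^{***}(x'',y'')\rangle$. Every normed space is identified with its canonical image in its second dual; in particular $B^*\subseteq B^{***}$ and $A^*\subseteq A^{***}$. Topological centers of module actions: $Z_{B^{**}}(A^{**})=\{a''\in A^{**}: b''\mapsto\pi_\ell^{***}(a'',b''),\ B^{**}\to B^{**}, \text{ is weak}^*\text{-to-weak}^*\text{ continuous}\}$, $Z_{A^{**}}(B^{**})=\{b''\in B^{**}: a''\mapsto\pi_r^{***}(b'',a''),\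 A^{**}\to B^{**}, \text{ is weak}^*\text{-to-weak}^*\text{ continuous}\}$. *)

theory Defs
  imports "HOL-Analysis.Analysis"
begin

text \<open>
  The scalar field is an arbitrary type \<open>'k\<close> of class \<^class>\<open>real_normed_field\<close>; by the
  Gelfand--Mazur theorem such a field is isometrically isomorphic to the reals or to the complex
  numbers.  The library classes only provide real scalars, so the scalar multiplication by \<open>'k\<close> is an explicit parameter.
  For \<open>'k = real\<close> it is forced to be \<^const>\<open>scaleR\<close>.
\<close>

locale normed_space_over = vector_space smul
  for smul :: "'k::real_normed_field \<Rightarrow> 'v::real_normed_vector \<Rightarrow> 'v" +
  assumes norm_smul: "norm (smul c x) = norm c * norm x"
    and smul_of_real: "smul (of_real r) x = r *\<^sub>R x"

locale banach_algebra_over = normed_space_over smul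
  for smul :: "'k::real_normed_field \<Rightarrow> 'a::{real_normed_algebra,banach} \<Rightarrow> 'a" +
  assumes smul_mult_left: "smul c x * y = smul c (x * y)"
    and smul_mult_right: "x * smul c y = smul c (x * y)"

text \<open>
  \<^const>\<open>bounded_bilinear\<close> only expresses bilinearity over the reals; homogeneity over \<open>'k\<close> is
  added.  Neither the algebra nor the modules are required to be unital, and the
  action is bounded by an arbitrary constant.
\<close>

locale left_banach_module =
  A: banach_algebra_over smulA + B: normed_space_over smulB
  for smulA :: "'k::real_normed_field \<Rightarrow> 'a::{real_normed_algebra,banach} \<Rightarrow> 'a"
    and smulB :: "'k \<Rightarrow> 'b::banach \<Rightarrow> 'b" +
  fixes act :: "'a \<Rightarrow> 'b \<Rightarrow> 'b"
  assumes bounded_bilinear_act: "bounded_bilinear act"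
    and act_smul_left: "act (smulA c a) b = smulB c (act a b)"
    and act_smul_right: "act a (smulB c b) = smulB c (act a b)"
    and act_act: "act a1 (act a2 b) = act (a1 * a2) b"

locale right_banach_module =
  A: banach_algebra_over smulA + B: normed_space_over smulB
  for smulA :: "'k::real_normed_field \<Rightarrow> 'a::{real_normed_algebra,banach} \<Rightarrow> 'a"
    and smulB :: "'k \<Rightarrow> 'b::banach \<Rightarrow> 'b" +
  fixes act :: "'b \<Rightarrow> 'a \<Rightarrow> 'b"
  assumes bounded_bilinear_act: "bounded_bilinear act"
    and act_smul_left: "act (smulB c b) a = smulB c (act b a)"
    and act_smul_right: "act b (smulA c a) = smulB c (act b a)"
    and act_act: "act (act b a1) a2 = act b (a1 * a2)"

text \<open>
  Iterated duals over \<open>'k\<close> are not available as types (\<^typ>\<open>'v \<Rightarrow>\<^sub>L 'k\<close> consists of all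
  real-linear maps), so normed spaces are also handled as structures with an explicit carrier.
  Functionals are \<^const>\<open>extensional\<close> on the carrier, which makes their equality the equality
  of functionals.
\<close>

record ('k, 'v) normed_struct =
  vecs :: "'v set"
  vadd :: "'v \<Rightarrow> 'v \<Rightarrow> 'v"
  vscale :: "'k \<Rightarrow> 'v \<Rightarrow> 'v"
  vnorm :: "'v \<Rightarrow> real"

definition type_space ::
  "('k \<Rightarrow> 'v \<Rightarrow> 'v) \<Rightarrow> ('k::real_normed_field, 'v::real_normed_vector) normed_struct" where
  "type_space smul = \<lparr>vecs = UNIV, vadd = (+), vscale = smul, vnorm = norm\<rparr>"

definition bounded_functional ::
  "('k::real_normed_field, 'v) normed_struct \<Rightarrow> ('v \<Rightarrow> 'k) \<Rightarrow> bool" where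
  "bounded_functional V f \<longleftrightarrow>
     (\<forall>x\<in>vecs V. \<forall>y\<in>vecs V. f (vadd V x y) = f x + f y) \<and>
     (\<forall>c. \<forall>x\<in>vecs V. f (vscale V c x) = c * f x) \<and>
     (\<exists>C. \<forall>x\<in>vecs V. norm (f x) \<le> C * vnorm V x)"

definition dual ::
  "('k::real_normed_field, 'v) normed_struct \<Rightarrow> ('k, 'v \<Rightarrow> 'k) normed_struct" where
  "dual V =
     \<lparr>vecs = {f \<in> extensional (vecs V). bounded_functional V f},
      vadd = (\<lambda>f g. \<lambda>x\<in>vecs V. f x + g x),
      vscale = (\<lambda>c f. \<lambda>x\<in>vecs V. c * f x),
      vnorm = (\<lambda>f. SUP x\<in>{x \<in> vecs V. vnorm V x \<le> 1}. norm (f x))\<rparr>"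

definition canonical ::
  "('k::real_normed_field, 'v) normed_struct \<Rightarrow> 'v \<Rightarrow> ('v \<Rightarrow> 'k) \<Rightarrow> 'k" where
  "canonical V x = (\<lambda>f\<in>vecs (dual V). f x)"

text \<open>The weak* topology on \<open>dual V\<close>, i.e. the topology of pointwise convergence on \<open>V\<close>.\<close>

definition weak_star ::
  "('k::real_normed_field, 'v) normed_struct \<Rightarrow> ('v \<Rightarrow> 'k) topology" where
  "weak_star V = subtopology (product_topology (\<lambda>_. euclidean) (vecs V)) (vecs (dual V))"

text \<open>
  For \<open>m : X \<times> Y \<rightarrow> Z\<close>, the map \<open>adj Y m : Z* \<times> X \<rightarrow> Y*\<close> is the adjoint; only the carrier of \<open>Y\<close>
  enters.  \<open>adj2\<close>, \<open>adj3\<close>, \<open>adj4\<close> are its iterates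
  \<open>Y** \<times> Z* \<rightarrow> X*\<close>, \<open>X** \<times> Y** \<rightarrow> Z**\<close> and \<open>Z*** \<times> X** \<rightarrow> Y***\<close>.
\<close>

definition adj ::
  "('k::real_normed_field, 'y) normed_struct \<Rightarrow> ('x \<Rightarrow> 'y \<Rightarrow> 'z) \<Rightarrow> ('z \<Rightarrow> 'k) \<Rightarrow> 'x \<Rightarrow> 'y \<Rightarrow> 'k" where
  "adj Y m = (\<lambda>z' x. \<lambda>y\<in>vecs Y. z' (m x y))"

definition adj2 ::
  "('k::real_normed_field, 'x) normed_struct \<Rightarrow> ('k, 'y) normed_struct \<Rightarrow> ('x \<Rightarrow> 'y \<Rightarrow> 'z) \<Rightarrow>
     (('y \<Rightarrow> 'k) \<Rightarrow> 'k) \<Rightarrow> ('z \<Rightarrow> 'k) \<Rightarrow> 'x \<Rightarrow> 'k" where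
  "adj2 X Y m = adj X (adj Y m)"

definition adj3 ::
  "('k::real_normed_field, 'x) normed_struct \<Rightarrow> ('k, 'y) normed_struct \<Rightarrow> ('k, 'z) normed_struct \<Rightarrow> ('x \<Rightarrow> 'y \<Rightarrow> 'z) \<Rightarrow>
     (('x \<Rightarrow> 'k) \<Rightarrow> 'k) \<Rightarrow> (('y \<Rightarrow> 'k) \<Rightarrow> 'k) \<Rightarrow> ('z \<Rightarrow> 'k) \<Rightarrow> 'k" where
  "adj3 X Y Z m = adj (dual Z) (adj2 X Y m)"

definition adj4 ::
  "('k::real_normed_field, 'x) normed_struct \<Rightarrow> ('k, 'y) normed_struct \<Rightarrow> ('k, 'z) normed_struct \<Rightarrow> ('x \<Rightarrow> 'y \<Rightarrow> 'z) \<Rightarrow>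
     ((('z \<Rightarrow> 'k) \<Rightarrow> 'k) \<Rightarrow> 'k) \<Rightarrow> (('x \<Rightarrow> 'k) \<Rightarrow> 'k) \<Rightarrow> (('y \<Rightarrow> 'k) \<Rightarrow> 'k) \<Rightarrow> 'k" where
  "adj4 X Y Z m = adj (dual (dual Y)) (adj3 X Y Z m)"

text \<open>
  The topological centers \<open>Z_{B**}(A**)\<close> of a left action \<open>A \<times> B \<rightarrow> B\<close> and \<open>Z_{A**}(B**)\<close> of a
  right action \<open>B \<times> A \<rightarrow> B\<close>.
\<close>

definition left_center ::
  "('k::real_normed_field, 'a) normed_struct \<Rightarrow> ('k, 'b) normed_struct \<Rightarrow> ('a \<Rightarrow> 'b \<Rightarrow> 'b) \<Rightarrow> (('a \<Rightarrow> 'k) \<Rightarrow> 'k) set" where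
  "left_center A B act =
     {a'' \<in> vecs (dual (dual A)).
        continuous_map (weak_star (dual B)) (weak_star (dual B))
          (\<lambda>b''. adj3 A B B act a'' b'')}"

definition right_center ::
  "('k::real_normed_field, 'a) normed_struct \<Rightarrow> ('k, 'b) normed_struct \<Rightarrow> ('b \<Rightarrow> 'a \<Rightarrow> 'b) \<Rightarrow> (('b \<Rightarrow> 'k) \<Rightarrow> 'k) set" where
  "right_center A B act =
     {b'' \<in> vecs (dual (dual B)).
        continuous_map (weak_star (dual A)) (weak_star (dual B))
          (\<lambda>a''. adj3 B A B act b'' a'')}"

end

(*
  Continuity into a weak* topology is tested coordinatewise, so x'' lies in the center iff for
  every z' the functional y'' |-> <m***(x'',y''), z'> = <m****(z',x''), y''> on Y** is weak*
  continuous.  A linear functional on a dual space is weak* continuous iff it is evaluation at a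
  point of the predual: continuity at 0 makes it vanish on the annihilator of a finite set, and
  then it is a linear combination of evaluations at the points of that set.
*)
theory Submission
  imports Defs
begin

section \<open>Seminormed structures and their bounded functionals\<close>

text \<open>These properties pass from \<open>V\<close> to \<open>dual V\<close> (see
  \<open>seminormed_struct_dual\<close>), so whatever follows from them is available at every level
  of the iterated duals.\<close>

locale seminormed_struct =
  fixes V :: "('k::real_normed_field, 'v) normed_struct"
  assumes vecs_nonempty: "vecs V \<noteq> {}"
    and vadd_closed: "x \<in> vecs V \<Longrightarrow> y \<in> vecs V \<Longrightarrow> vadd V x y \<in> vecs V"
    and vscale_closed: "x \<in> vecs V \<Longrightarrow> vscale V c x \<in> vecs V"
    and vnorm_nonneg: "x \<in> vecs V \<Longrightarrow> 0 \<le> vnorm V x"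
    and vnorm_vscale: "x \<in> vecs V \<Longrightarrow> vnorm V (vscale V c x) = norm c * vnorm V x"

lemma seminormed_struct_type_space:
  assumes "normed_space_over smul"
  shows "seminormed_struct (type_space smul)"
proof -
  interpret normed_space_over smul by fact
  show ?thesis
    by unfold_locales (auto simp: type_space_def norm_smul)
qed

lemma vadd_dual [simp]: "x \<in> vecs V \<Longrightarrow> vadd (dual V) f g x = f x + g x"
  and vscale_dual [simp]: "x \<in> vecs V \<Longrightarrow> vscale (dual V) c f x = c * f x"
  by (simp_all add: dual_def)

lemma dual_vecsD:
  assumes "f \<in> vecs (dual V)"
  shows dual_extensional: "f \<in> extensional (vecs V)"
    and dual_add: "x \<in> vecs V \<Longrightarrow> y \<in> vecs V \<Longrightarrow> f (vadd V x y) = f x + f y"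
    and dual_scale: "x \<in> vecs V \<Longrightarrow> f (vscale V c x) = c * f x"
  using assms by (auto simp: dual_def bounded_functional_def)

context seminormed_struct
begin

lemma dual_bound_ex:
  assumes "f \<in> vecs (dual V)"
  obtains C where "C \<ge> 0" "\<And>x. x \<in> vecs V \<Longrightarrow> norm (f x) \<le> C * vnorm V x"
proof -
  obtain C where C: "\<And>x. x \<in> vecs V \<Longrightarrow> norm (f x) \<le> C * vnorm V x"
    using assms unfolding dual_def bounded_functional_def by force
  \<comment> \<open>The constant from boundedness may be negative if all seminorms are 0; its
    absolute value serves as well.\<close>
  have "norm (f x) \<le> \<bar>C\<bar> * vnorm V x" if "x \<in> vecs V" for x
    using C[OF that] mult_right_mono[OF abs_ge_self vnorm_nonneg[OF that], of C] by linarith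
  then show thesis
    using that[of "\<bar>C\<bar>"] by simp
qed

lemma dual_vecsI:
  assumes "f \<in> extensional (vecs V)"
    and "\<And>x y. x \<in> vecs V \<Longrightarrow> y \<in> vecs V \<Longrightarrow> f (vadd V x y) = f x + f y"
    and "\<And>c x. x \<in> vecs V \<Longrightarrow> f (vscale V c x) = c * f x"
    and "\<And>x. x \<in> vecs V \<Longrightarrow> norm (f x) \<le> C * vnorm V x"
  shows "f \<in> vecs (dual V)"
  using assms unfolding dual_def bounded_functional_def by simp blast

lemma dual_zero: "(\<lambda>x\<in>vecs V. 0) \<in> vecs (dual V)"
  by (rule dual_vecsI[where C = 0]) (auto simp: vadd_closed vscale_closed)

lemma dual_vadd_closed:
  assumes f: "f \<in> vecs (dual V)" and g: "g \<in> vecs (dual V)"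
  shows "vadd (dual V) f g \<in> vecs (dual V)"
proof -
  obtain C where C: "\<And>x. x \<in> vecs V \<Longrightarrow> norm (f x) \<le> C * vnorm V x"
    using dual_bound_ex[OF f] by blast
  obtain D where D: "\<And>x. x \<in> vecs V \<Longrightarrow> norm (g x) \<le> D * vnorm V x"
    using dual_bound_ex[OF g] by blast
  show ?thesis
  proof (rule dual_vecsI[where C = "C + D"])
    show "vadd (dual V) f g \<in> extensional (vecs V)"
      by (simp add: dual_def)
    fix x assume x: "x \<in> vecs V"
    have "norm (f x + g x) \<le> C * vnorm V x + D * vnorm V x"
      by (rule norm_triangle_mono[OF C[OF x] D[OF x]])
    then show "norm (vadd (dual V) f g x) \<le> (C + D) * vnorm V x"
      using x by (simp add: distrib_right)
  qed (use f g in \<open>auto simp: vadd_closed vscale_closed dual_add dual_scale algebra_simps\<close>)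
qed

lemma dual_vscale_closed:
  assumes f: "f \<in> vecs (dual V)"
  shows "vscale (dual V) c f \<in> vecs (dual V)"
proof -
  obtain C where C: "\<And>x. x \<in> vecs V \<Longrightarrow> norm (f x) \<le> C * vnorm V x"
    using dual_bound_ex[OF f] by blast
  show ?thesis
  proof (rule dual_vecsI[where C = "norm c * C"])
    show "vscale (dual V) c f \<in> extensional (vecs V)"
      by (simp add: dual_def)
    fix x assume x: "x \<in> vecs V"
    show "norm (vscale (dual V) c f x) \<le> norm c * C * vnorm V x"
      using mult_left_mono[OF C[OF x] norm_ge_zero[of c]] x by (simp add: norm_mult mult.assoc)
  qed (use f in \<open>auto simp: vadd_closed vscale_closed dual_add dual_scale algebra_simps\<close>)
qed

section \<open>The dual norm as a supremum over the unit ball\<close>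

lemma vnorm_dual_eq: "vnorm (dual V) f = (SUP x\<in>{x \<in> vecs V. vnorm V x \<le> 1}. norm (f x))"
  by (simp add: dual_def)

text \<open>Needed for bounding the supremum in the dual norm. No zero vector is named in the
  structure; a zero multiple of any vector has seminorm 0.\<close>

lemma unit_ball_nonempty: "{x \<in> vecs V. vnorm V x \<le> 1} \<noteq> {}"
proof -
  obtain x where "x \<in> vecs V" using vecs_nonempty by blast
  then have "vscale V 0 x \<in> {x \<in> vecs V. vnorm V x \<le> 1}"
    by (simp add: vscale_closed vnorm_vscale)
  then show ?thesis by blast
qed

lemma vnorm_dual_le:
  assumes "\<And>x. x \<in> vecs V \<Longrightarrow> norm (f x) \<le> C * vnorm V x" and "C \<ge> 0"
  shows "vnorm (dual V) f \<le> C"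
  unfolding vnorm_dual_eq
proof (rule cSUP_least[OF unit_ball_nonempty])
  fix x assume "x \<in> {x \<in> vecs V. vnorm V x \<le> 1}"
  then show "norm (f x) \<le> C"
    using assms(1)[of x] mult_left_mono[of "vnorm V x" 1 C] assms(2) by simp
qed

lemma norm_le_vnorm_dual_of_unit:
  assumes f: "f \<in> vecs (dual V)" and x: "x \<in> vecs V" "vnorm V x \<le> 1"
  shows "norm (f x) \<le> vnorm (dual V) f"
proof -
  obtain C where C: "C \<ge> 0" "\<And>x. x \<in> vecs V \<Longrightarrow> norm (f x) \<le> C * vnorm V x"
    using dual_bound_ex[OF f] by blast
  \<comment> \<open>The real supremum is an upper bound only if the set is bounded above; any bound
    of \<open>f\<close> provides this on the unit ball.\<close>
  have "norm (f y) \<le> C" if "y \<in> vecs V" "vnorm V y \<le> 1" for y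
    using C(2)[OF that(1)] mult_left_mono[OF that(2) C(1)] by simp
  then have "bdd_above ((\<lambda>x. norm (f x)) ` {x \<in> vecs V. vnorm V x \<le> 1})"
    by (auto intro!: bdd_aboveI2)
  then show ?thesis
    unfolding vnorm_dual_eq using x by (intro cSUP_upper) auto
qed

lemma vnorm_dual_nonneg:
  assumes "f \<in> vecs (dual V)"
  shows "0 \<le> vnorm (dual V) f"
proof -
  obtain x where "x \<in> vecs V" "vnorm V x \<le> 1" using unit_ball_nonempty by blast
  from norm_le_vnorm_dual_of_unit[OF assms this] show ?thesis
    using norm_ge_zero order_trans by blast
qed

lemma norm_le_vnorm_dual:
  assumes f: "f \<in> vecs (dual V)" and x: "x \<in> vecs V"
  shows "norm (f x) \<le> vnorm (dual V) f * vnorm V x"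
proof (cases "vnorm V x = 0")
  \<comment> \<open>Here \<open>x\<close> cannot be rescaled to seminorm 1, but any bound of
    \<open>f\<close> already forces \<open>f x = 0\<close>.\<close>
  case True
  obtain C where "\<And>x. x \<in> vecs V \<Longrightarrow> norm (f x) \<le> C * vnorm V x"
    using dual_bound_ex[OF f] by blast
  from this[OF x] True show ?thesis by simp
next
  case False
  then have pos: "vnorm V x > 0" using vnorm_nonneg[OF x] by simp
  define c :: 'k where "c = of_real (inverse (vnorm V x))"
  have c: "norm c = inverse (vnorm V x)"
    using pos by (simp add: c_def norm_inverse)
  have "vnorm V (vscale V c x) \<le> 1"
    using pos by (simp add: vnorm_vscale[OF x] c)
  from norm_le_vnorm_dual_of_unit[OF f vscale_closed[OF x] this]
  show ?thesis
    using pos by (simp add: dual_scale[OF f x] norm_mult c field_simps)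
qed

section \<open>Weak* continuous functionals are evaluations\<close>

text \<open>Induction on \<open>F\<close>, removing one point \<open>w\<close> at a time by
  subtracting a multiple of evaluation at \<open>w\<close>; hence \<open>f\<close> must vary in the
  induction. A linear combination of evaluations is evaluation at the same combination of points, so
  one \<open>v\<close> suffices.\<close>

lemma functional_eq_evaluation_if_vanishes_on_annihilator:
  assumes "finite F" "F \<subseteq> vecs V"
    and "\<And>x y. x \<in> vecs (dual V) \<Longrightarrow> y \<in> vecs (dual V) \<Longrightarrow> f (vadd (dual V) x y) = f x + f y"
    and "\<And>c x. x \<in> vecs (dual V) \<Longrightarrow> f (vscale (dual V) c x) = c * f x"
    and "\<And>x. x \<in> vecs (dual V) \<Longrightarrow> (\<forall>v\<in>F. x v = 0) \<Longrightarrow> f x = 0"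
  shows "\<exists>v\<in>vecs V. \<forall>x\<in>vecs (dual V). f x = x v"
  using assms
proof (induction F arbitrary: f rule: finite_induct)
  case empty
  obtain v where v: "v \<in> vecs V" using vecs_nonempty by blast
  \<comment> \<open>The annihilator of the empty set is everything, so \<open>f\<close> vanishes;
    \<open>vscale V 0 v\<close> plays the zero vector.\<close>
  have "\<forall>x\<in>vecs (dual V). f x = x (vscale V 0 v)"
    using empty.prems(4) v by (simp add: dual_scale)
  then show ?case using vscale_closed[OF v] by blast
next
  case (insert w F)
  have w: "w \<in> vecs V" using insert.prems(1) by simp
  show ?case
  proof (cases "\<forall>x\<in>vecs (dual V). (\<forall>v\<in>F. x v = 0) \<longrightarrow> x w = 0")
    \<comment> \<open>Vanishing on \<open>F\<close> already implies vanishing at \<open>w\<close>,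
      so \<open>f\<close> itself satisfies the hypothesis for \<open>F\<close>.\<close>
    case True
    show ?thesis
      by (rule insert.IH) (use insert.prems True in auto)
  next
    case False
    then obtain x0 where x0: "x0 \<in> vecs (dual V)" "\<And>v. v \<in> F \<Longrightarrow> x0 v = 0" "x0 w \<noteq> 0"
      by blast
    \<comment> \<open>The only coefficient for which \<open>g\<close> vanishes at
      \<open>x0\<close>.\<close>
    define k where "k = f x0 / x0 w"
    define g where "g = (\<lambda>x. f x - k * x w)"
    have "\<exists>v\<in>vecs V. \<forall>x\<in>vecs (dual V). g x = x v"
    proof (rule insert.IH)
      fix x assume x: "x \<in> vecs (dual V)" and xF: "\<forall>v\<in>F. x v = 0"
      \<comment> \<open>Subtracting this multiple of \<open>x0\<close> makes the value at
        \<open>w\<close> zero and keeps the zeros on \<open>F\<close>. Then \<open>f y = 0\<close>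
        reads \<open>f x = (x w / x0 w) * f x0 = k * x w\<close>, that is,
        \<open>g x = 0\<close>.\<close>
      define y where "y = vadd (dual V) x (vscale (dual V) (- (x w / x0 w)) x0)"
      have s: "vscale (dual V) (- (x w / x0 w)) x0 \<in> vecs (dual V)"
        by (rule dual_vscale_closed[OF x0(1)])
      have "y v = 0" if "v \<in> insert w F" for v
        using that x0 xF insert.prems(1) by (auto simp: y_def subset_iff)
      then have "f y = 0"
        using insert.prems(4) dual_vadd_closed[OF x s] y_def by blast
      then show "g x = 0"
        using x0(3)
        by (simp add: y_def insert.prems(2)[OF x s] insert.prems(3)[OF x0(1)] g_def k_def)
    qed (use insert.prems w in \<open>auto simp: g_def algebra_simps\<close>)
    then obtain v where v: "v \<in> vecs V" "\<forall>x\<in>vecs (dual V). g x = x v" by blast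
    have "f x = x (vadd V v (vscale V k w))" if x: "x \<in> vecs (dual V)" for x
      using v(2)[rule_format, OF x] x v(1) w
      by (simp add: dual_add dual_scale vscale_closed g_def algebra_simps)
    then show ?thesis
      using vadd_closed[OF v(1) vscale_closed[OF w]] by blast
  qed
qed

lemma topspace_weak_star: "topspace (weak_star V) = vecs (dual V)"
  by (auto simp: weak_star_def dual_def PiE_UNIV_domain PiE_def)

lemma continuous_map_evaluation:
  assumes "v \<in> vecs V"
  shows "continuous_map (weak_star V) euclidean (\<lambda>x. x v)"
  unfolding weak_star_def
  using assms by (intro continuous_map_from_subtopology continuous_map_product_projection)

lemma weak_star_continuous_functional:
  assumes add: "\<And>x y. x \<in> vecs (dual V) \<Longrightarrow> y \<in> vecs (dual V) \<Longrightarrow>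
      f (vadd (dual V) x y) = f x + f y"
    and scale: "\<And>c x. x \<in> vecs (dual V) \<Longrightarrow> f (vscale (dual V) c x) = c * f x"
    and cont: "continuous_map (weak_star V) euclidean f"
  shows "\<exists>v\<in>vecs V. \<forall>x\<in>vecs (dual V). f x = x v"
proof -
  define z :: "'v \<Rightarrow> 'k" where "z = (\<lambda>x\<in>vecs V. 0)"
  have z: "z \<in> vecs (dual V)"
    unfolding z_def by (rule dual_zero)
  have "vscale (dual V) 0 z = z"
    by (simp add: dual_def z_def fun_eq_iff)
  then have fz: "f z = 0"
    using scale[OF z, of 0] by simp
  \<comment> \<open>The preimage of the unit ball is a weak* neighbourhood of the zero functional
    \<open>z\<close>. It contains the dual vectors of a basic box \<open>U\<close> around
    \<open>z\<close>, which restricts only finitely many coordinates; these form the set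
    \<open>F\<close>.\<close>
  have "openin (weak_star V) {x \<in> topspace (weak_star V). f x \<in> ball 0 1}"
    using openin_continuous_map_preimage[OF cont, of "ball 0 1"] by (simp flip: open_openin)
  then obtain T where T: "openin (product_topology (\<lambda>_. euclidean) (vecs V)) T"
      "{x \<in> vecs (dual V). f x \<in> ball 0 1} = T \<inter> vecs (dual V)"
    unfolding topspace_weak_star unfolding weak_star_def openin_subtopology by blast
  have "z \<in> {x \<in> vecs (dual V). f x \<in> ball 0 1}" using z fz by simp
  then have "z \<in> T" unfolding T(2) by blast
  then obtain U where U: "finite {i \<in> vecs V. U i \<noteq> UNIV}"
      "z \<in> Pi\<^sub>E (vecs V) U" "Pi\<^sub>E (vecs V) U \<subseteq> T"
    using T(1) unfolding openin_product_topology_alt topspace_euclidean by meson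
  show ?thesis
  proof (rule functional_eq_evaluation_if_vanishes_on_annihilator)
    fix x assume x: "x \<in> vecs (dual V)" and x0: "\<forall>v\<in>{i \<in> vecs V. U i \<noteq> UNIV}. x v = 0"
    show "f x = 0"
    proof (rule ccontr)
      assume nz: "f x \<noteq> 0"
      \<comment> \<open>Rescaling gives \<open>f y = 1\<close>. But \<open>y\<close> is still 0 at
        every restricted coordinate, so it stays in the box, where \<open>f\<close> has norm below
        1.\<close>
      define y where "y = vscale (dual V) (1 / f x) x"
      have y: "y \<in> vecs (dual V)"
        unfolding y_def by (rule dual_vscale_closed[OF x])
      have "y i \<in> U i" if i: "i \<in> vecs V" for i
      proof (cases "U i = UNIV")
        case False
        then have "y i = z i" using x0 i by (simp add: y_def z_def)
        then show ?thesis using U(2) i by (auto simp: PiE_iff)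
      qed simp
      then have "y \<in> Pi\<^sub>E (vecs V) U"
        using dual_extensional[OF y] by (simp add: PiE_iff)
      then have "y \<in> {x \<in> vecs (dual V). f x \<in> ball 0 1}"
        unfolding T(2) using U(3) y by blast
      then have "norm (f y) < 1" by simp
      then show False using nz by (simp add: y_def scale[OF x])
    qed
  qed (use U add scale in auto)
qed

lemma continuous_map_into_weak_star:
  assumes "\<And>x. x \<in> topspace S \<Longrightarrow> h x \<in> vecs (dual V)"
  shows "continuous_map S (weak_star V) h \<longleftrightarrow>
    (\<forall>v\<in>vecs V. continuous_map S euclidean (\<lambda>x. h x v))"
  using assms
  by (auto simp: weak_star_def continuous_map_in_subtopology continuous_map_componentwise
      image_subset_iff dest: dual_extensional)

end

section \<open>Passing to the dual\<close>

lemma seminormed_struct_dual: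
  assumes "seminormed_struct V"
  shows "seminormed_struct (dual V)"
proof -
  interpret seminormed_struct V by fact
  have le: "vnorm (dual V) (vscale (dual V) c f) \<le> norm c * vnorm (dual V) f"
    if f: "f \<in> vecs (dual V)" for c f
  proof (rule vnorm_dual_le)
    fix x assume x: "x \<in> vecs V"
    show "norm (vscale (dual V) c f x) \<le> norm c * vnorm (dual V) f * vnorm V x"
      using mult_left_mono[OF norm_le_vnorm_dual[OF f x] norm_ge_zero[of c]] x
      by (simp add: norm_mult mult.assoc)
  qed (simp add: vnorm_dual_nonneg[OF f])
  \<comment> \<open>For \<open>c\<close> nonzero this is \<open>le\<close> applied to
    \<open>inverse c\<close> and the functional \<open>vscale (dual V) c f\<close>.\<close>
  have ge: "norm c * vnorm (dual V) f \<le> vnorm (dual V) (vscale (dual V) c f)"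
    if f: "f \<in> vecs (dual V)" for c f
  proof (cases "c = 0")
    case True
    then show ?thesis
      using vnorm_dual_nonneg[OF dual_vscale_closed[OF f]] by simp
  next
    case False
    \<comment> \<open>An equality of functions on the whole type: off \<open>vecs V\<close> both
      sides are \<open>undefined\<close>, since \<open>f\<close> is extensional.\<close>
    have "vscale (dual V) (inverse c) (vscale (dual V) c f) = f"
      using False dual_extensional[OF f]
      by (auto simp: dual_def fun_eq_iff extensional_def)
    with le[OF dual_vscale_closed[OF f, of c], of "inverse c"]
    have "vnorm (dual V) f \<le> inverse (norm c) * vnorm (dual V) (vscale (dual V) c f)"
      by (simp add: norm_inverse)
    then show ?thesis using False by (simp add: field_simps)
  qed
  show ?thesis
  proof
    show "vecs (dual V) \<noteq> {}" using dual_zero by blast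
  qed (use dual_vadd_closed dual_vscale_closed vnorm_dual_nonneg le ge in \<open>auto intro: antisym\<close>)
qed

section \<open>Bounded bilinear maps and their iterated adjoints\<close>

locale bounded_bilinear_struct =
  X: seminormed_struct X + Y: seminormed_struct Y + Z: seminormed_struct Z
  for X :: "('k::real_normed_field, 'x) normed_struct"
    and Y :: "('k, 'y) normed_struct"
    and Z :: "('k, 'z) normed_struct" +
  fixes m :: "'x \<Rightarrow> 'y \<Rightarrow> 'z"
  assumes m_closed: "x \<in> vecs X \<Longrightarrow> y \<in> vecs Y \<Longrightarrow> m x y \<in> vecs Z"
    and m_add_left: "x \<in> vecs X \<Longrightarrow> x2 \<in> vecs X \<Longrightarrow> y \<in> vecs Y \<Longrightarrow>
      m (vadd X x x2) y = vadd Z (m x y) (m x2 y)"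
    and m_add_right: "x \<in> vecs X \<Longrightarrow> y \<in> vecs Y \<Longrightarrow> y2 \<in> vecs Y \<Longrightarrow>
      m x (vadd Y y y2) = vadd Z (m x y) (m x y2)"
    and m_scale_left: "x \<in> vecs X \<Longrightarrow> y \<in> vecs Y \<Longrightarrow> m (vscale X c x) y = vscale Z c (m x y)"
    and m_scale_right: "x \<in> vecs X \<Longrightarrow> y \<in> vecs Y \<Longrightarrow> m x (vscale Y c y) = vscale Z c (m x y)"
    and m_bounded: "\<exists>K\<ge>0. \<forall>x\<in>vecs X. \<forall>y\<in>vecs Y. vnorm Z (m x y) \<le> K * (vnorm X x * vnorm Y y)"
begin

text \<open>The constant of \<open>m\<close> also bounds the adjoint, by |f(m x y)| \<le> ||f|| K
  ||x|| ||y||. Linearity of \<open>m\<close> in \<open>y\<close> puts the values into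
  \<open>dual Y\<close>, linearity in \<open>x\<close> carries over, and linearity in
  \<open>f\<close> is pointwise. As the result is of the same kind, the lemma can be
  iterated.\<close>

lemma adj_bounded_bilinear_struct: "bounded_bilinear_struct (dual Z) X (dual Y) (adj Y m)"
proof -
  obtain K where K: "K \<ge> 0"
    "\<And>x y. x \<in> vecs X \<Longrightarrow> y \<in> vecs Y \<Longrightarrow> vnorm Z (m x y) \<le> K * (vnorm X x * vnorm Y y)"
    using m_bounded by blast
  interpret dY: seminormed_struct "dual Y"
    by (rule seminormed_struct_dual) unfold_locales
  interpret dZ: seminormed_struct "dual Z"
    by (rule seminormed_struct_dual) unfold_locales
  have bound: "norm (adj Y m f x y) \<le> K * (vnorm (dual Z) f * vnorm X x) * vnorm Y y"
    if f: "f \<in> vecs (dual Z)" and x: "x \<in> vecs X" and y: "y \<in> vecs Y" for f x y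
  proof -
    have "norm (f (m x y)) \<le> vnorm (dual Z) f * vnorm Z (m x y)"
      by (rule Z.norm_le_vnorm_dual[OF f m_closed[OF x y]])
    also have "\<dots> \<le> vnorm (dual Z) f * (K * (vnorm X x * vnorm Y y))"
      by (rule mult_left_mono[OF K(2)[OF x y] dZ.vnorm_nonneg[OF f]])
    finally show ?thesis using y by (simp add: adj_def ac_simps)
  qed
  show ?thesis
  proof
    fix f x assume f: "f \<in> vecs (dual Z)" and x: "x \<in> vecs X"
    show "adj Y m f x \<in> vecs (dual Y)"
    proof (rule Y.dual_vecsI[OF _ _ _ bound[OF f x]])
      show "adj Y m f x \<in> extensional (vecs Y)"
        unfolding adj_def by (rule restrict_extensional)
    qed (use f x in \<open>auto simp: adj_def m_add_right m_scale_right m_closed Y.vadd_closed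
          Y.vscale_closed dual_add dual_scale\<close>)
  next
    have "vnorm (dual Y) (adj Y m f x) \<le> K * (vnorm (dual Z) f * vnorm X x)"
      if f: "f \<in> vecs (dual Z)" and x: "x \<in> vecs X" for f x
      using bound[OF f x] K(1) dZ.vnorm_nonneg[OF f] X.vnorm_nonneg[OF x]
      by (intro Y.vnorm_dual_le) auto
    then show "\<exists>K\<ge>0. \<forall>f\<in>vecs (dual Z). \<forall>x\<in>vecs X.
        vnorm (dual Y) (adj Y m f x) \<le> K * (vnorm (dual Z) f * vnorm X x)"
      using K(1) by blast
  qed (auto simp: fun_eq_iff adj_def dual_def[of Y] m_closed m_add_left m_scale_left
      dual_add dual_scale)
qed

text \<open>With three unrelated spaces, one statement covers both module actions.\<close>

lemma continuous_adj3_iff: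
  assumes x'': "x'' \<in> vecs (dual (dual X))"
  shows "continuous_map (weak_star (dual Y)) (weak_star (dual Z)) (adj3 X Y Z m x'') \<longleftrightarrow>
    (\<forall>z'\<in>vecs (dual Z).
      adj4 X Y Z m (canonical (dual Z) z') x'' \<in> canonical (dual Y) ` vecs (dual Y))"
proof -
  \<comment> \<open>Each adjoint shifts the spaces: \<open>m1.X\<close> and \<open>m1.Z\<close> are
    the facts about \<open>dual Z\<close> and \<open>dual Y\<close>, the preduals of the two weak*
    topologies, and \<open>m3\<close> is bilinearity of \<open>adj3\<close>.\<close>
  interpret m1: bounded_bilinear_struct "dual Z" X "dual Y" "adj Y m"
    by (rule adj_bounded_bilinear_struct)
  interpret m2: bounded_bilinear_struct "dual (dual Y)" "dual Z" "dual X" "adj2 X Y m"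
    unfolding adj2_def by (rule m1.adj_bounded_bilinear_struct)
  interpret m3: bounded_bilinear_struct "dual (dual X)" "dual (dual Y)" "dual (dual Z)" "adj3 X Y Z m"
    unfolding adj3_def by (rule m2.adj_bounded_bilinear_struct)
  \<comment> \<open>\<open>canonical (dual Z) z'\<close> evaluates at \<open>z'\<close> only on
    \<open>vecs (dual (dual Z))\<close>, so membership of the values of \<open>adj3\<close> there is
    essential.\<close>
  have adj4: "adj4 X Y Z m (canonical (dual Z) z') x'' =
      (\<lambda>y''\<in>vecs (dual (dual Y)). adj3 X Y Z m x'' y'' z')" for z'
    using m3.m_closed[OF x''] by (auto simp: adj4_def adj_def canonical_def fun_eq_iff)
  have "continuous_map (weak_star (dual Y)) euclidean (\<lambda>y''. adj3 X Y Z m x'' y'' z') \<longleftrightarrow>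
      adj4 X Y Z m (canonical (dual Z) z') x'' \<in> canonical (dual Y) ` vecs (dual Y)"
    (is "?cont \<longleftrightarrow> ?ev") if z': "z' \<in> vecs (dual Z)" for z'
  proof
    assume ?cont
    \<comment> \<open>The predual is \<open>dual Y\<close> here, so the point of evaluation is a
      functional \<open>y'\<close> on \<open>Y\<close>.\<close>
    have "\<exists>y'\<in>vecs (dual Y). \<forall>y''\<in>vecs (dual (dual Y)). adj3 X Y Z m x'' y'' z' = y'' y'"
      by (rule m1.Z.weak_star_continuous_functional[
            where f = "\<lambda>y''. adj3 X Y Z m x'' y'' z'", OF _ _ \<open>?cont\<close>])
        (use x'' z' in \<open>simp_all add: m3.m_add_right m3.m_scale_right\<close>)
    then obtain y' where y': "y' \<in> vecs (dual Y)"
      and eq: "\<And>y''. y'' \<in> vecs (dual (dual Y)) \<Longrightarrow> adj3 X Y Z m x'' y'' z' = y'' y'"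
      by blast
    have "adj4 X Y Z m (canonical (dual Z) z') x'' = canonical (dual Y) y'"
      unfolding adj4 unfolding canonical_def by (rule restrict_ext) (rule eq)
    then show ?ev using y' by blast
  next
    assume ?ev
    then obtain y' where y': "y' \<in> vecs (dual Y)"
      and eq: "(\<lambda>y''\<in>vecs (dual (dual Y)). adj3 X Y Z m x'' y'' z') = canonical (dual Y) y'"
      unfolding adj4 by auto
    have "y'' y' = adj3 X Y Z m x'' y'' z'" if "y'' \<in> vecs (dual (dual Y))" for y''
      using fun_cong[OF eq, of y''] that by (simp add: canonical_def)
    with m1.Z.continuous_map_evaluation[OF y'] show ?cont
      by (rule continuous_map_eq) (simp add: m1.Z.topspace_weak_star)
  qed
  then show ?thesis
    by (subst m1.X.continuous_map_into_weak_star)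
      (simp_all add: m1.Z.topspace_weak_star m3.m_closed[OF x''])
qed

end

section \<open>Application to module actions\<close>

lemma bounded_bilinear_struct_type_space:
  assumes "normed_space_over smulX" "normed_space_over smulY" "normed_space_over smulZ"
    and "bounded_bilinear m"
    and "\<And>c x y. m (smulX c x) y = smulZ c (m x y)"
    and "\<And>c x y. m x (smulY c y) = smulZ c (m x y)"
  shows "bounded_bilinear_struct (type_space smulX) (type_space smulY) (type_space smulZ) m"
proof -
  interpret m: bounded_bilinear m by fact
  interpret X: seminormed_struct "type_space smulX"
    by (rule seminormed_struct_type_space) fact
  interpret Y: seminormed_struct "type_space smulY"
    by (rule seminormed_struct_type_space) fact
  interpret Z: seminormed_struct "type_space smulZ"
    by (rule seminormed_struct_type_space) fact
  show ?thesis
  proof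
    show "\<exists>K\<ge>0. \<forall>x\<in>vecs (type_space smulX). \<forall>y\<in>vecs (type_space smulY).
        vnorm (type_space smulZ) (m x y) \<le>
        K * (vnorm (type_space smulX) x * vnorm (type_space smulY) y)"
      using m.nonneg_bounded by (auto simp: type_space_def ac_simps)
  qed (auto simp: type_space_def m.add_left m.add_right assms(5,6))
qed

theorem mainTheorem1:
  fixes smulA :: "'k::real_normed_field \<Rightarrow> 'a::{real_normed_algebra,banach} \<Rightarrow> 'a"
    and smulL :: "'k \<Rightarrow> 'l::banach \<Rightarrow> 'l"
    and smulR :: "'k \<Rightarrow> 'r::banach \<Rightarrow> 'r"
  assumes "banach_algebra_over smulA"
  shows
    "(let A = type_space smulA; B = type_space smulL in
      \<forall>\<pi>l. left_banach_module smulA smulL \<pi>l \<longrightarrow>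
        (\<forall>a''\<in>vecs (dual (dual A)).
          a'' \<in> left_center A B \<pi>l \<longleftrightarrow>
          (\<forall>b'\<in>vecs (dual B).
             adj4 A B B \<pi>l (canonical (dual B) b') a'' \<in> canonical (dual B) ` vecs (dual B)))) \<and>
     (let A = type_space smulA; B = type_space smulR in
      \<forall>\<pi>r. right_banach_module smulA smulR \<pi>r \<longrightarrow>
        (\<forall>b''\<in>vecs (dual (dual B)).
          b'' \<in> right_center A B \<pi>r \<longleftrightarrow>
          (\<forall>b'\<in>vecs (dual B).
             adj4 B A B \<pi>r (canonical (dual B) b') b'' \<in> canonical (dual A) ` vecs (dual A))))"
proof -
  have A: "normed_space_over smulA"
    using assms by (simp add: banach_algebra_over_def)
  have left: "a'' \<in> left_center (type_space smulA) (type_space smulL) \<pi>l \<longleftrightarrow>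
      (\<forall>b'\<in>vecs (dual (type_space smulL)).
        adj4 (type_space smulA) (type_space smulL) (type_space smulL) \<pi>l
          (canonical (dual (type_space smulL)) b') a''
        \<in> canonical (dual (type_space smulL)) ` vecs (dual (type_space smulL)))"
    if "left_banach_module smulA smulL \<pi>l" "a'' \<in> vecs (dual (dual (type_space smulA)))"
    for \<pi>l a''
  proof -
    interpret left_banach_module smulA smulL \<pi>l by fact
    \<comment> \<open>The roles are X = A and Y = Z = B.\<close>
    interpret bounded_bilinear_struct "type_space smulA" "type_space smulL" "type_space smulL" \<pi>l
      by (rule bounded_bilinear_struct_type_space)
        (fact A B.normed_space_over_axioms bounded_bilinear_act act_smul_left act_smul_right)+
    show ?thesis
      using continuous_adj3_iff[OF that(2)] that(2) by (simp add: left_center_def)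
  qed
  have right: "b'' \<in> right_center (type_space smulA) (type_space smulR) \<pi>r \<longleftrightarrow>
      (\<forall>b'\<in>vecs (dual (type_space smulR)).
        adj4 (type_space smulR) (type_space smulA) (type_space smulR) \<pi>r
          (canonical (dual (type_space smulR)) b') b''
        \<in> canonical (dual (type_space smulA)) ` vecs (dual (type_space smulA)))"
    if "right_banach_module smulA smulR \<pi>r" "b'' \<in> vecs (dual (dual (type_space smulR)))"
    for \<pi>r b''
  proof -
    interpret right_banach_module smulA smulR \<pi>r by fact
    \<comment> \<open>Now X = Z = B and Y = A, so the evaluation points lie in the dual of
      A.\<close>
    interpret bounded_bilinear_struct "type_space smulR" "type_space smulA" "type_space smulR" \<pi>r
      by (rule bounded_bilinear_struct_type_space)
        (fact A B.normed_space_over_axioms bounded_bilinear_act act_smul_left act_smul_right)+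
    show ?thesis
      using continuous_adj3_iff[OF that(2)] that(2) by (simp add: right_center_def)
  qed
  show ?thesis
    unfolding Let_def using left right by blast
qed

end
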